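(* For an arbitrary irreducible distance regular $k$-coloring of the $n$-dimensional rectangular grid $\mathbb{Z}^n$, it holds that $k\le 2n+1$. An irreducible distance regular $(2n+1)$-coloring of $\mathbb{Z}^n$ exists.
   Context: $\mathbb{Z}^n$ denotes the infinite graph of the $n$-dimensional rectangular grid: its vertices are the integer vectors of length $n$, and ${\bf x},{\bf y}$ are adjacent iff ${\bf y}-{\bf x}\in\{\pm{\bf e^1},\ldots,\pm{\bf e^n}\}$, where ${\bf e^i}$ is the $i$-th unit coordinate vector. A $k$-coloring is a function $\varphi$ from the vertices to $\{1,\ldots,k\}$, equivalently a partition of the vertices into $k$ color classes $C_i=\{{\bf x} : \varphi({\bf x})=i\}$, $i=1,\ldots,k$. It is perfect with parameter matrix $A=(\alpha_{ij})_{k\times k}$ if, for all $i,j\in\{1,\ldots,k\}$, every vertex of color $i$ has exactly $\alpha_{ij}$ adjacent vertices of color $j$. A perfect coloring is distance regular if there exists an ordering of the colors with respect to which the parameter matrix is three-diagonal (i.e. $\alpha_{ij}=0$ whenever $|i-j|>1$, with colors numbered in that order). A $k$-coloring $\varphi$ of $\mathbb{Z}^n$ is reducible if there exist a $k$-coloring $\varphi_1$ of $\mathbb{Z}^1$ and $\delta_1,\ldots,\delta_n\in\{0,1,-1\}$ such that $\varphi(x_1,\ldots,x_n)=\varphi_1(\delta_1x_1+\ldots+\delta_nx_n)$ for all $(x_1,\ldots,x_n)\in\mathbb{Z}^n$. It is irreducible if it is not reducible.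
   Formalization: The existence of an irreducible distance regular (2n+1)-coloring is stated only for n ≥ 2, because for n = 1 every coloring of Z^1 is reducible (take φ_1 = φ, δ_1 = 1), so none exists; the bound k ≤ 2n+1 is stated for all n ≥ 1. *)

theory Defs
  imports "HOL-Analysis.Finite_Cartesian_Product"
begin

definition grid_adj :: "int ^ 'n \<Rightarrow> int ^ 'n \<Rightarrow> bool" where
  "grid_adj x y \<longleftrightarrow> (\<exists>i. y - x = axis i 1 \<or> y - x = - axis i 1)"

text \<open>
  Being equivalent to a partition into \<open>k\<close> color classes, a \<open>k\<close>-coloring is required to use all
  \<open>k\<close> colors. With unused colors allowed, the corresponding rows of a parameter matrix would be
  unconstrained and no upper bound on \<open>k\<close> could hold.
\<close>

definition grid_coloring :: "nat \<Rightarrow> (int ^ 'n \<Rightarrow> nat) \<Rightarrow> bool" where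
  "grid_coloring k \<phi> \<longleftrightarrow> range \<phi> = {1..k}"

definition perfect_coloring :: "nat \<Rightarrow> (nat \<Rightarrow> nat \<Rightarrow> nat) \<Rightarrow> (int ^ 'n \<Rightarrow> nat) \<Rightarrow> bool" where
  "perfect_coloring k A \<phi> \<longleftrightarrow> grid_coloring k \<phi> \<and>
     (\<forall>i\<in>{1..k}. \<forall>j\<in>{1..k}. \<forall>x. \<phi> x = i \<longrightarrow> card {y. grid_adj x y \<and> \<phi> y = j} = A i j)"

text \<open>Neighborhoods are finite, so \<open>card\<close> above is a genuine count.\<close>

lemma finite_grid_neighbors: "finite {y. grid_adj x y \<and> P y}"
proof (rule finite_subset)
  show "{y. grid_adj x y \<and> P y} \<subseteq> range (\<lambda>i. x + axis i 1) \<union> range (\<lambda>i. x - axis i 1)"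
    by (auto simp: grid_adj_def algebra_simps)
qed simp

text \<open>The bijection \<open>\<pi>\<close> lists the colors in an order making the parameter matrix three-diagonal.\<close>

definition distance_regular_coloring :: "nat \<Rightarrow> (int ^ 'n \<Rightarrow> nat) \<Rightarrow> bool" where
  "distance_regular_coloring k \<phi> \<longleftrightarrow>
     (\<exists>A. perfect_coloring k A \<phi> \<and>
       (\<exists>\<pi>. bij_betw \<pi> {1..k} {1..k} \<and>
         (\<forall>i\<in>{1..k}. \<forall>j\<in>{1..k}. \<bar>int i - int j\<bar> > 1 \<longrightarrow> A (\<pi> i) (\<pi> j) = 0)))"

definition reducible_coloring :: "nat \<Rightarrow> (int ^ 'n \<Rightarrow> nat) \<Rightarrow> bool" where
  "reducible_coloring k \<phi> \<longleftrightarrow>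
     (\<exists>(\<phi>\<^sub>1 :: int ^ 1 \<Rightarrow> nat) (\<delta> :: 'n \<Rightarrow> int).
       grid_coloring k \<phi>\<^sub>1 \<and> (\<forall>i. \<delta> i \<in> {0, 1, -1}) \<and>
       (\<forall>x. \<phi> x = \<phi>\<^sub>1 (\<chi> _. \<Sum>i\<in>UNIV. \<delta> i * x $ i)))"

abbreviation irreducible_coloring :: "nat \<Rightarrow> (int ^ 'n \<Rightarrow> nat) \<Rightarrow> bool" where
  "irreducible_coloring k \<phi> \<equiv> \<not> reducible_coloring k \<phi>"

end

theory Submission imports Defs
begin

text \<open>
  Number the colors so that the parameter matrix is three-diagonal and read the coloring as a
  level function \<open>h\<close> with values \<open>0, \<dots>, K\<close>, \<open>K = k - 1\<close>, that changes by at most one along every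
  edge; a vertex of level \<open>i\<close> has \<open>b i\<close> upward and \<open>c i\<close> downward directions among the
  \<open>2n\<close> directions \<open>\<plusminus>e\<^sub>j\<close>. A reducible coloring is one whose level only depends on a linear form
  with coefficients in \<open>{0, 1, -1}\<close>.

  \<^bold>\<open>Upper bound.\<close> Going up along a direction \<open>d\<close> closes a square: every downward direction \<open>e\<close> of
  \<open>x\<close> is downward at \<open>x + d\<close> too, because \<open>x + d + e\<close> is adjacent both to \<open>x + d\<close> and to \<open>x + e\<close>.
  Hence \<open>c\<close> grows and \<open>b\<close> decreases with the level. If \<open>c\<close> does not grow from \<open>i\<close> to
  \<open>i + 1\<close>, then the opposite of every upward direction at level \<open>i\<close> is downward, so
  \<open>b i \<le> c i\<close>; dually for \<open>b\<close>. So \<open>c\<close> grows strictly while \<open>c < b\<close>, and \<open>b\<close> decreases strictly once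
  \<open>b < c\<close>. As \<open>b + c \<le> 2n\<close>, more than \<open>2n + 1\<close> levels are possible only if two consecutive levels
  \<open>i, i + 1\<close> are balanced: \<open>b = c = m\<close> on both (\<open>balanced_pair_exists\<close>).

  A balanced pair forces rigidity. The set \<open>U\<close> of upward directions at a vertex of level \<open>i\<close>
  contains no two opposite directions, so it consists of the directions on which some sign vector
  \<open>\<delta>\<close> takes the value 1. On the two layers \<open>\<delta> \<bullet> (x - x0) \<in> {0, 1}\<close> the set of upward directions
  stays equal to \<open>U\<close> and the level equals \<open>i + \<delta> \<bullet> (x - x0)\<close> (\<open>balanced_slab\<close>). The adjacent
  layers then have constant levels, and so do those next to them: this makes level \<open>i - 1\<close> either
  balanced with the same \<open>m\<close> or the bottom level (\<open>below_balanced_pair\<close>). Descending, and ascending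
  by symmetry, all \<open>b\<close> and \<open>c\<close> lie in \<open>{0, m, 2m}\<close>. With these parameters, constancy of the
  level on two consecutive layers propagates to all layers (\<open>rows_constant\<close>), and the coloring is
  reducible.

  \<^bold>\<open>Sharpness.\<close> Reduction modulo 4 maps the grid onto a product of \<open>n\<close> cycles of length 4, which is
  the hypercube of dimension \<open>2n\<close>. The distance to a fixed vertex of the hypercube, that is the
  Lee weight modulo 4, gives \<open>2n + 1\<close> levels with \<open>c i = i\<close>, \<open>b i = 2n - i\<close>. For
  \<open>n \<ge> 2\<close> the coloring is irreducible: the weight vanishes only where all coordinates are
  multiples of 4, whereas every sign form also vanishes at other vectors.
\<close>

section \<open>Directions of the grid and linear forms\<close>

definition dirs :: "(int ^ 'n) set" where
  "dirs = range (\<lambda>i. axis i 1) \<union> range (\<lambda>i. - axis i 1)"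

lemma finite_dirs [simp]: "finite (dirs :: (int ^ 'n) set)"
  by (simp add: dirs_def)

lemma uminus_dirs [simp]: "- d \<in> dirs \<longleftrightarrow> d \<in> dirs"
proof -
  have "- d \<in> dirs" if "d \<in> dirs" for d :: "int ^ 'n"
    using that by (auto simp: dirs_def)
  from this[of d] this[of "- d"] show ?thesis by auto
qed

lemma dirs_cases:
  assumes "d \<in> dirs"
  obtains i where "d = axis i 1" | i where "d = - axis i 1"
  using assms by (auto simp: dirs_def)

lemma grid_adj_iff: "grid_adj x y \<longleftrightarrow> y - x \<in> dirs"
  by (auto simp: grid_adj_def dirs_def)

lemma card_neighbors: "card {y. grid_adj x y \<and> P y} = card {d \<in> dirs. P (x + d)}"
proof (rule sym, rule bij_betw_same_card)
  show "bij_betw (\<lambda>d. x + d) {d \<in> dirs. P (x + d)} {y. grid_adj x y \<and> P y}"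
    by (rule bij_betw_byWitness[where f' = "\<lambda>y. y - x"]) (auto simp: grid_adj_iff)
qed

lemma axis_int_eq_iff [simp]: "axis i (1::int) = axis j 1 \<longleftrightarrow> i = j"
  by (simp add: axis_eq_axis)

lemma axis_neq_uminus_axis [simp]: "axis i (1::int) \<noteq> - axis j 1"
proof
  assume "axis i (1::int) = - axis j 1"
  then have "axis i (1::int) $ i = (- axis j 1) $ i"
    by simp
  then show False
    by (simp add: axis_def split: if_splits)
qed

lemma card_dirs_filter:
  "card {d \<in> dirs. P d} =
    (\<Sum>i\<in>UNIV. of_bool (P (axis i 1)) + of_bool (P (- axis i (1::int) :: int ^ 'n)))"
proof -
  let ?p = "\<lambda>i. axis i (1::int) :: int ^ 'n" and ?q = "\<lambda>i. - axis i (1::int) :: int ^ 'n"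
  have eq: "{d \<in> dirs. P d} = ?p ` {i. P (?p i)} \<union> ?q ` {i. P (?q i)}"
    by (auto simp: dirs_def)
  have "card {d \<in> dirs. P d} = card (?p ` {i. P (?p i)}) + card (?q ` {i. P (?q i)})"
    unfolding eq by (rule card_Un_disjoint) auto
  also have "\<dots> = card {i. P (?p i)} + card {i. P (?q i)}"
    by (simp add: card_image inj_on_def)
  also have "\<dots> = (\<Sum>i\<in>UNIV. of_bool (P (?p i)) + of_bool (P (?q i)))"
    by (simp add: sum.distrib)
  finally show ?thesis .
qed

lemma card_dirs: "card (dirs :: (int ^ 'n) set) = 2 * CARD('n)"
  using card_dirs_filter[of "\<lambda>_ :: int ^ 'n. True"] by simp

definition lin :: "('n::finite \<Rightarrow> int) \<Rightarrow> int ^ 'n \<Rightarrow> int" where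
  "lin \<delta> x = (\<Sum>i\<in>UNIV. \<delta> i * x $ i)"

lemma lin_zero [simp]: "lin \<delta> 0 = 0"
  and lin_add: "lin \<delta> (x + y) = lin \<delta> x + lin \<delta> y"
  and lin_diff: "lin \<delta> (x - y) = lin \<delta> x - lin \<delta> y"
  and lin_minus: "lin \<delta> (- x) = - lin \<delta> x"
  and lin_neg: "lin (\<lambda>i. - \<delta> i) x = - lin \<delta> x"
  by (simp_all add: lin_def algebra_simps sum.distrib sum_subtractf sum_negf)

lemma lin_axis [simp]: "lin \<delta> (axis i t) = \<delta> i * t"
  by (simp add: lin_def axis_def if_distrib cong: if_cong)

abbreviation sign_pattern :: "('n \<Rightarrow> int) \<Rightarrow> bool" where
  "sign_pattern \<delta> \<equiv> \<forall>i. \<delta> i \<in> {0, 1, -1}"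

lemma sign_pattern_neg: "sign_pattern \<delta> \<Longrightarrow> sign_pattern (\<lambda>i. - \<delta> i)"
  by auto

lemma lin_dir_cases:
  assumes "sign_pattern \<delta>" "d \<in> dirs"
  shows "lin \<delta> d = -1 \<or> lin \<delta> d = 0 \<or> lin \<delta> d = 1"
  using assms(2)
proof (cases rule: dirs_cases)
  case (1 i)
  then show ?thesis using assms(1)[rule_format, of i] by auto
next
  case (2 i)
  then show ?thesis using assms(1)[rule_format, of i] by (auto simp: lin_minus)
qed

text \<open>
  When \<open>\<delta>\<close> is a sign vector, the form \<open>lin \<delta>\<close> takes values in \<open>{-1, 0, 1}\<close> on the directions, and
  its ascents and their opposites are the directions leaving a layer \<open>lin \<delta> x = t\<close>.
\<close>

definition ascents :: "('n::finite \<Rightarrow> int) \<Rightarrow> (int ^ 'n) set" where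
  "ascents \<delta> = {d \<in> dirs. lin \<delta> d = 1}"

lemma finite_ascents [simp]: "finite (ascents \<delta>)"
  by (simp add: ascents_def)

lemma ascents_neg: "ascents (\<lambda>i. - \<delta> i) = uminus ` ascents \<delta>"
proof -
  have "d \<in> uminus ` ascents \<delta> \<longleftrightarrow> - d \<in> ascents \<delta>" for d
    using imageI[of "- d" "ascents \<delta>" uminus] by (simp add: image_iff) (metis minus_minus)
  then show ?thesis
    by (simp add: set_eq_iff) (simp add: ascents_def lin_neg lin_minus)
qed

lemma descents_eq: "{d \<in> dirs. lin \<delta> d = -1} = uminus ` ascents \<delta>"
proof -
  have "{d \<in> dirs. lin \<delta> d = -1} = ascents (\<lambda>i. - \<delta> i)"
    unfolding ascents_def lin_neg by (rule Collect_cong) linarith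
  then show ?thesis
    by (simp only: ascents_neg)
qed

lemma uminus_ascents_iff: "d \<in> dirs \<Longrightarrow> d \<in> uminus ` ascents \<delta> \<longleftrightarrow> lin \<delta> d = -1"
  by (simp add: descents_eq[symmetric])

lemma ascents_disjoint: "ascents \<delta> \<inter> uminus ` ascents \<delta> = {}"
  by (auto simp: ascents_def lin_minus)

text \<open>
  An antipode-free set contains at most one of the two directions of each axis, and recording which
  one gives the sign vector. This turns the combinatorial set of upward directions at one vertex
  into a linear form on the whole grid.
\<close>

lemma antipode_free_ascents:
  assumes "U \<subseteq> dirs" "\<And>u. u \<in> U \<Longrightarrow> - u \<notin> U"
  obtains \<delta> :: "'n::finite \<Rightarrow> int" where "sign_pattern \<delta>" "U = ascents \<delta>"
proof
  define \<delta> :: "'n \<Rightarrow> int" where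
    "\<delta> = (\<lambda>i. if axis i 1 \<in> U then 1 else if - axis i 1 \<in> U then -1 else 0)"
  show "sign_pattern \<delta>"
    by (simp add: \<delta>_def)
  have opp: "axis i 1 \<in> U \<Longrightarrow> - axis i 1 \<notin> U" for i
    by (rule assms(2))
  have "d \<in> U \<longleftrightarrow> lin \<delta> d = 1" if "d \<in> dirs" for d
    using that
  proof (cases rule: dirs_cases)
    case (1 i)
    then show ?thesis by (simp add: \<delta>_def)
  next
    case (2 i)
    then show ?thesis using opp[of i] by (simp add: \<delta>_def lin_minus)
  qed
  then show "U = ascents \<delta>"
    using assms(1) by (auto simp: ascents_def)
qed

text \<open>
  Two consecutive layers of a sign vector form a connected subgraph, so that a property of \<open>x0\<close>
  that survives steps inside the slab holds on all of it. The path to \<open>x0\<close> strictly decreases the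
  \<open>l\<^sub>1\<close> distance: from the upper layer some coordinate can be moved towards \<open>x0\<close> by a
  descending step; from the lower layer, some coordinate that differs from \<open>x0\<close> can be moved by a
  step that is ascending or stays in the layer.
\<close>

lemma slab_induct [consumes 2, case_names base step]:
  fixes \<delta> :: "'n::finite \<Rightarrow> int"
  assumes \<delta>: "sign_pattern \<delta>" and y: "lin \<delta> (y - x0) \<in> {0, 1}"
    and base: "P x0"
    and step: "\<And>x d. P x \<Longrightarrow> d \<in> dirs \<Longrightarrow> lin \<delta> (x - x0) \<in> {0, 1} \<Longrightarrow>
                 lin \<delta> (x + d - x0) \<in> {0, 1} \<Longrightarrow> P (x + d)"
  shows "P y"
  using y
proof (induction "\<Sum>i\<in>UNIV. nat \<bar>(y - x0) $ i\<bar>" arbitrary: y rule: less_induct)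
  case less
  show ?case
  proof (cases "y = x0")
    case True
    then show ?thesis using base by simp
  next
    case False
    define z where "z = y - x0"
    have z0: "z \<noteq> 0" using False by (simp add: z_def)
    have toward: ?thesis
      if zj: "z $ j \<noteq> 0" and l: "lin \<delta> z - \<delta> j * sgn (z $ j) \<in> {0, 1}" for j
    proof -
      define d :: "int ^ 'n" where "d = axis j (sgn (z $ j))"
      have "d = axis j 1 \<or> d = - axis j 1"
        using zj by (auto simp: d_def sgn_if vec_eq_iff axis_def)
      then have d: "d \<in> dirs" by (auto simp: dirs_def)
      have lt: "nat \<bar>(y - d - x0) $ j\<bar> < nat \<bar>(y - x0) $ j\<bar>"
        using zj by (auto simp: d_def z_def sgn_if)
      have le: "nat \<bar>(y - d - x0) $ i\<bar> \<le> nat \<bar>(y - x0) $ i\<bar>" for i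
        using lt by (cases "i = j") (auto simp: d_def axis_def)
      have "(\<Sum>i\<in>UNIV. nat \<bar>(y - d - x0) $ i\<bar>) < (\<Sum>i\<in>UNIV. nat \<bar>(y - x0) $ i\<bar>)"
        by (rule sum_strict_mono_ex1) (use lt le in auto)
      moreover have ld: "lin \<delta> (y - d - x0) \<in> {0, 1}"
        using l by (auto simp: d_def z_def lin_diff)
      ultimately have "P (y - d)" by (rule less.hyps)
      from step[OF this d ld] show ?thesis using less.prems by simp
    qed
    consider "lin \<delta> z = 1" | "lin \<delta> z = 0"
      using less.prems by (auto simp: z_def)
    then show ?thesis
    proof cases
      case 1
      have "\<exists>j. \<delta> j * z $ j > 0"
      proof (rule ccontr)
        assume "\<not> ?thesis"
        then have "lin \<delta> z \<le> 0"
          unfolding lin_def by (intro sum_nonpos) (simp add: not_less)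
        with 1 show False by simp
      qed
      then obtain j where j: "\<delta> j * z $ j > 0" ..
      moreover have "\<delta> j * sgn (z $ j) = 1"
        using j \<delta>[rule_format, of j] by (auto simp: sgn_if)
      ultimately show ?thesis
        by (intro toward[of j]) (auto simp: 1)
    next
      case 2
      have "\<exists>j. z $ j \<noteq> 0 \<and> \<delta> j * z $ j \<le> 0"
      proof (rule ccontr)
        assume "\<not> ?thesis"
        then have *: "\<And>j. z $ j \<noteq> 0 \<Longrightarrow> \<delta> j * z $ j > 0" by force
        obtain j where j: "z $ j \<noteq> 0" using z0 by (auto simp: vec_eq_iff)
        have "lin \<delta> z > 0"
          unfolding lin_def
        proof (rule sum_pos2[of _ j])
          show "0 \<le> \<delta> i * z $ i" for i
            using *[of i] by (cases "z $ i = 0") auto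
        qed (use * j in auto)
        with 2 show False by simp
      qed
      then obtain j where j: "z $ j \<noteq> 0" "\<delta> j * z $ j \<le> 0" by auto
      moreover have "\<delta> j * sgn (z $ j) \<in> {0, -1}"
        using j \<delta>[rule_format, of j] by (auto simp: sgn_if split: if_splits)
      ultimately show ?thesis
        by (intro toward[of j]) (auto simp: 2)
    qed
  qed
qed

text \<open>
  For \<open>\<delta> = 0\<close> the slab is the whole grid.
\<close>

lemma grid_connected:
  assumes "P x0" "\<And>x d. P x \<Longrightarrow> d \<in> dirs \<Longrightarrow> P (x + d)"
  shows "P y"
proof -
  have "sign_pattern (\<lambda>_. 0)" "lin (\<lambda>_. 0) (y - x0) \<in> {0, 1}"
    by (simp_all add: lin_def)
  then show ?thesis
  proof (induction rule: slab_induct)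
    case base
    show ?case by (rule assms(1))
  next
    case (step x d)
    show ?case by (rule assms(2)[OF step(1,2)])
  qed
qed

section \<open>Level functions and monotonicity of their parameters\<close>

definition up :: "(int ^ 'n \<Rightarrow> int) \<Rightarrow> int ^ 'n \<Rightarrow> (int ^ 'n) set" where
  "up h x = {d \<in> dirs. h (x + d) = h x + 1}"

definition down :: "(int ^ 'n \<Rightarrow> int) \<Rightarrow> int ^ 'n \<Rightarrow> (int ^ 'n) set" where
  "down h x = {d \<in> dirs. h (x + d) = h x - 1}"

lemma up_reverse: "up (\<lambda>x. K - h x) x = down h x"
  and down_reverse: "down (\<lambda>x. K - h x) x = up h x"
  by (auto simp: up_def down_def)

lemma finite_up [simp]: "finite (up h x)" and finite_down [simp]: "finite (down h x)"
  by (auto simp: up_def down_def)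

lemma up_down_disjoint: "up h x \<inter> down h x = {}"
  by (auto simp: up_def down_def)

lemma uminus_up_down:
  "d \<in> up h x \<Longrightarrow> - d \<in> down h (x + d)" "d \<in> down h x \<Longrightarrow> - d \<in> up h (x + d)"
  by (simp_all add: up_def down_def)

lemma card_uminus_image: "card (uminus ` (U :: 'a :: group_add set)) = card U"
  by (rule card_image) simp

text \<open>
  A distance regular coloring with ordered colors. The ordering may be reversed, which exchanges
  \<open>b\<close> and \<open>c\<close>; every fact below comes with its mirror image through \<open>reverse\<close>.
\<close>

locale leveling =
  fixes h :: "int ^ 'n::finite \<Rightarrow> int" and K :: int and b c :: "int \<Rightarrow> nat"
  assumes range_h: "range h = {0..K}"
    and h_step: "d \<in> dirs \<Longrightarrow> \<bar>h (x + d) - h x\<bar> \<le> 1"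
    and card_up: "card (up h x) = b (h x)"
    and card_down: "card (down h x) = c (h x)"
begin

lemma h_bounds: "0 \<le> h x" "h x \<le> K"
proof -
  have "h x \<in> {0..K}" unfolding range_h[symmetric] by (rule rangeI)
  then show "0 \<le> h x" "h x \<le> K" by simp_all
qed

lemma level_nonempty:
  assumes "0 \<le> t" "t \<le> K" shows "\<exists>x. h x = t"
proof -
  have "t \<in> range h" using assms by (simp add: range_h)
  then show ?thesis by auto
qed

lemma reverse: "leveling (\<lambda>x. K - h x) K (\<lambda>i. c (K - i)) (\<lambda>i. b (K - i))"
proof
  show "range (\<lambda>x. K - h x) = {0..K}"
  proof (intro equalityI subsetI)
    fix t assume "t \<in> {0..K}"
    then obtain x where "h x = K - t" using level_nonempty[of "K - t"] by auto
    then show "t \<in> range (\<lambda>x. K - h x)" by (intro image_eqI[of _ _ x]) auto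
  next
    fix t assume "t \<in> range (\<lambda>x. K - h x)"
    then obtain x where "t = K - h x" by (rule rangeE)
    then show "t \<in> {0..K}" using h_bounds[of x] by simp
  qed
next
  show "\<bar>(K - h (x + d)) - (K - h x)\<bar> \<le> 1" if "d \<in> dirs" for d x
    using h_step[OF that, of x] by linarith
qed (simp_all add: up_reverse down_reverse card_up card_down)

lemma bc_le: "b (h x) + c (h x) \<le> 2 * CARD('n)"
proof -
  have "card (up h x) + card (down h x) = card (up h x \<union> down h x)"
    by (rule card_Un_disjoint[symmetric]) (auto simp: up_down_disjoint)
  also have "\<dots> \<le> card (dirs :: (int ^ 'n) set)"
    by (rule card_mono) (auto simp: up_def down_def)
  finally show ?thesis by (simp add: card_up card_down card_dirs)
qed

text \<open>
  A level without upward directions would confine the whole connected grid to the levels below it.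
\<close>

lemma b_pos:
  assumes "0 \<le> t" "t < K" shows "b t > 0"
proof (rule ccontr)
  assume "\<not> b t > 0"
  then have no_up: "up h x = {}" if "h x = t" for x
    using card_up[of x] that by simp
  obtain x0 where x0: "h x0 = t" using level_nonempty[of t] assms by auto
  have "h y \<le> t" for y
  proof (rule grid_connected[where P = "\<lambda>y. h y \<le> t" and ?x0.0 = x0])
    fix x d assume *: "h x \<le> t" "d \<in> (dirs :: (int ^ 'n) set)"
    have "h (x + d) \<noteq> t + 1" if "h x = t"
      using no_up[OF that] that *(2) by (auto simp: up_def)
    then show "h (x + d) \<le> t"
      using h_step[OF *(2), of x] *(1) by (cases "h x = t") auto
  qed (simp add: x0)
  moreover obtain y where "h y = K" using level_nonempty[of K] assms by auto
  ultimately show False using assms by (metis not_le)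
qed

lemma c_pos:
  assumes "0 < t" "t \<le> K" shows "c t > 0"
  using leveling.b_pos[OF reverse, of "K - t"] assms by simp

lemma c_0: "c 0 = 0"
proof -
  have "0 \<le> K" using h_bounds[of undefined] by simp
  then obtain x where x: "h x = 0" using level_nonempty[of 0] by auto
  have "h (x + d) \<noteq> h x - 1" for d using h_bounds(1)[of "x + d"] x by linarith
  then have "down h x = {}" by (simp add: down_def)
  then show ?thesis using card_down[of x] x by simp
qed

lemma b_K: "b K = 0"
  using leveling.c_0[OF reverse] by simp

text \<open>
  The square with vertices \<open>x\<close>, \<open>x + d\<close>, \<open>x + e\<close>, \<open>x + d + e\<close> pins the level of its fourth vertex,
  which is adjacent to levels that differ by two.
\<close>

lemma down_subset:
  assumes "d \<in> up h x" shows "down h x \<subseteq> down h (x + d)"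
proof
  fix e assume e: "e \<in> down h x"
  have "d \<in> dirs" "e \<in> dirs" using assms e by (auto simp: up_def down_def)
  then have "\<bar>h (x + e + d) - h (x + e)\<bar> \<le> 1" "\<bar>h (x + d + e) - h (x + d)\<bar> \<le> 1"
    using h_step by blast+
  moreover have "x + e + d = x + d + e" by simp
  ultimately show "e \<in> down h (x + d)"
    using assms e \<open>e \<in> dirs\<close> by (auto simp: up_def down_def)
qed

lemma up_subset:
  assumes "d \<in> up h x" shows "up h (x + d) \<subseteq> up h x"
proof -
  have "- d \<in> down h (x + d)" using assms by (rule uminus_up_down)
  then show ?thesis
    using leveling.down_subset[OF reverse, of "- d" "x + d"] by (simp add: up_reverse down_reverse)
qed

lemma c_mono:
  assumes "0 \<le> t" "t < K" shows "c t \<le> c (t + 1)"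
proof -
  obtain x where x: "h x = t" using level_nonempty[of t] assms by auto
  obtain d where d: "d \<in> up h x" using b_pos[OF assms] card_up[of x] x by fastforce
  have "card (down h x) \<le> card (down h (x + d))"
    using down_subset[OF d] by (intro card_mono) auto
  then show ?thesis using d x by (simp add: card_down up_def)
qed

lemma b_antimono:
  assumes "0 \<le> t" "t < K" shows "b (t + 1) \<le> b t"
  using leveling.c_mono[OF reverse, of "K - t - 1"] assms by (simp add: algebra_simps)

text \<open>
  The direction back from \<open>x + d\<close> to \<open>x\<close> is downward at \<open>x + d\<close>. When the number of downward
  directions does not change, \<open>x\<close> and \<open>x + d\<close> have the same ones, so it is downward at \<open>x\<close> as well.
\<close>

lemma uminus_up_subset_down:
  assumes "c (h x) = c (h x + 1)" shows "uminus ` up h x \<subseteq> down h x"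
proof clarify
  fix d assume d: "d \<in> up h x"
  have "card (down h x) = card (down h (x + d))"
    using d assms by (simp add: card_down up_def)
  then have "down h x = down h (x + d)"
    using down_subset[OF d] by (intro card_subset_eq) auto
  then show "- d \<in> down h x" using uminus_up_down(1)[OF d] by simp
qed

lemma uminus_down_subset_up:
  assumes "b (h x) = b (h x - 1)" shows "uminus ` down h x \<subseteq> up h x"
  using leveling.uminus_up_subset_down[OF reverse, of x] assms
  by (simp add: up_reverse down_reverse algebra_simps)

lemma b_le_c:
  assumes "0 \<le> t" "t \<le> K" "c t = c (t + 1)" shows "b t \<le> c t"
proof -
  obtain x where x: "h x = t" using level_nonempty[of t] assms by auto
  have "card (uminus ` up h x) \<le> card (down h x)"
    using uminus_up_subset_down[of x] x assms by (intro card_mono) auto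
  then show ?thesis using x by (simp add: card_uminus_image card_up card_down)
qed

lemma c_le_b:
  assumes "0 \<le> t" "t \<le> K" "b t = b (t - 1)" shows "c t \<le> b t"
  using leveling.b_le_c[OF reverse, of "K - t"] assms by (simp add: algebra_simps)

section \<open>Balanced pairs of levels\<close>

text \<open>
  Let \<open>p\<close> be the last level with \<open>c p \<le> b p\<close>. Above \<open>p\<close> the sequence \<open>b\<close> is strictly decreasing, so
  \<open>b p \<ge> K - p\<close>. If \<open>c < b\<close> at all levels below \<open>p\<close>, then \<open>c\<close> is strictly increasing there and
  \<open>c p \<ge> p\<close>, which gives \<open>K \<le> b p + c p \<le> 2n\<close>. Otherwise monotonicity squeezes \<open>b\<close> and \<open>c\<close>
  to a common value on the levels \<open>p - 1\<close> and \<open>p\<close>.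
\<close>

lemma balanced_pair_exists:
  assumes K: "K > 2 * int CARD('n)"
  obtains i m where "0 < i" "i + 1 < K" "0 < m"
    "c i = m" "b i = m" "c (i + 1) = m" "b (i + 1) = m"
proof -
  define S where "S = {t \<in> {0..K}. c t \<le> b t}"
  define p where "p = Max S"
  have K0: "K > 0" using K by simp
  have "finite S" unfolding S_def by (rule finite_subset[of _ "{0..K}"]) auto
  moreover have "0 \<in> S" using K0 by (simp add: S_def c_0)
  ultimately have pS: "p \<in> S" and pmax: "\<And>t. t \<in> S \<Longrightarrow> t \<le> p"
    unfolding p_def by (auto intro: Max_in)
  have p: "0 \<le> p" "p \<le> K" "c p \<le> b p" using pS by (auto simp: S_def)
  have above: "b t < c t" if "p < t" "t \<le> K" for t
    using pmax[of t] that p by (force simp: S_def)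
  have pK: "p < K" using p c_pos[of K] b_K K0 by (cases "p = K") auto
  have b_drop: "int (b (K - int j)) \<ge> int j" if "int j \<le> K - p" for j
    using that
  proof (induction j)
    case (Suc j)
    have t: "0 \<le> K - int j - 1" "K - int j - 1 < K" using Suc.prems p by auto
    have "b (K - int j) \<noteq> b (K - int j - 1)"
      using c_le_b[of "K - int j"] above[of "K - int j"] Suc.prems t by force
    then have "b (K - int j) < b (K - int j - 1)"
      using b_antimono[OF t] by simp
    then show ?case using Suc by (simp add: algebra_simps)
  qed simp
  have bp: "int (b p) \<ge> K - p"
    using b_drop[of "nat (K - p)"] p by simp
  show ?thesis
  proof (cases "\<forall>t. 0 \<le> t \<and> t < p \<longrightarrow> c t < b t")
    case True
    have "int (c (int j)) \<ge> int j" if "int j \<le> p" for j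
      using that
    proof (induction j)
      case (Suc j)
      have t: "0 \<le> int j" "int j < K" using Suc.prems p by auto
      have "c (int j) \<noteq> c (int j + 1)"
        using b_le_c[of "int j"] True[rule_format, of "int j"] Suc.prems t by auto
      then have "c (int j) < c (int j + 1)"
        using c_mono[OF t] by simp
      then show ?case using Suc by (simp add: algebra_simps)
    qed simp
    from this[of "nat p"] have cp: "int (c p) \<ge> p" using p by simp
    obtain x where "h x = p" using level_nonempty[of p] p by auto
    then have "b p + c p \<le> 2 * CARD('n)" using bc_le[of x] by simp
    then show ?thesis using bp cp K by linarith
  next
    case False
    then obtain t where t: "0 \<le> t" "t < p" "b t \<le> c t" by force
    have mono: "c t \<le> c (t + int j) \<and> b (t + int j) \<le> b t" if "t + int j \<le> K" for j
      using that
    proof (induction j)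
      case (Suc j)
      then show ?case
        using c_mono[of "t + int j"] b_antimono[of "t + int j"] t by (auto simp: algebra_simps)
    qed simp
    have 1: "c t \<le> c (p - 1)" "b (p - 1) \<le> b t"
      using mono[of "nat (p - 1 - t)"] t p by auto
    have 2: "c (p - 1) \<le> c p" "b p \<le> b (p - 1)"
      using c_mono[of "p - 1"] b_antimono[of "p - 1"] t p by auto
    define m where "m = b p"
    have eq: "c (p - 1) = m" "b (p - 1) = m" "c p = m" "b p = m"
      using 1 2 t p by (auto simp: m_def)
    have m: "0 < m" using b_pos[of p] p pK by (simp add: m_def)
    moreover have "p - 1 \<noteq> 0"
    proof
      assume "p - 1 = 0"
      then have "c (p - 1) = c 0" by simp
      then show False using eq(1) m c_0 by linarith
    qed
    ultimately show ?thesis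
      by (intro that[of "p - 1" m]) (use eq t pK in auto)
  qed
qed

text \<open>
  On balanced levels the downward directions are exactly the opposites of the upward ones, and the
  upward directions do not change along an edge between the levels \<open>i\<close> and \<open>i + 1\<close>. They do
  not change along an edge \<open>d\<close> inside a layer either: such a \<open>d\<close> preserves the level at \<open>x\<close> and also at the
  neighbor of \<open>x\<close> in the other layer, so the connecting edge keeps its type when it is shifted by \<open>d\<close>.
  Connectivity of the slab does the rest.
\<close>

lemma balanced_slab:
  assumes \<delta>: "sign_pattern \<delta>"
    and bal: "c i = m" "b i = m" "c (i + 1) = m" "b (i + 1) = m"
    and x0: "h x0 = i" "up h x0 = ascents \<delta>"
    and y: "lin \<delta> (y - x0) \<in> {0, 1}"
  shows "h y = i + lin \<delta> (y - x0)" "up h y = ascents \<delta>" "down h y = uminus ` ascents \<delta>"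
proof -
  have opp: "down h x = uminus ` up h x" if "h x \<in> {i, i + 1}" for x
  proof (cases "h x = i")
    case True
    then show ?thesis
      using uminus_up_subset_down[of x] bal
      by (intro card_subset_eq[symmetric]) (auto simp: card_uminus_image card_up card_down)
  next
    case False
    then have "uminus ` down h x = up h x"
      using uminus_down_subset_up[of x] bal that
      by (intro card_subset_eq) (auto simp: card_uminus_image card_up card_down)
    then have "uminus ` uminus ` down h x = uminus ` up h x" by simp
    then show ?thesis by (simp add: image_comp)
  qed
  have up_step: "up h (x + d) = up h x" if "d \<in> up h x" "h x = i" for x d
  proof -
    have "h (x + d) = i + 1" using that by (simp add: up_def)
    then have "card (up h (x + d)) = card (up h x)" using that(2) bal by (simp add: card_up)
    then show ?thesis using up_subset[OF that(1)] by (intro card_subset_eq) auto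
  qed
  have step1: "h (x + d) = i + lin \<delta> (x + d - x0) \<and> up h (x + d) = ascents \<delta>"
    if hx: "h x = i + lin \<delta> (x - x0)" and ux: "up h x = ascents \<delta>" and d: "d \<in> dirs"
      and s: "lin \<delta> (x - x0) \<in> {0, 1}" "lin \<delta> (x + d - x0) \<in> {0, 1}" for x d
  proof -
    have l: "lin \<delta> (x + d - x0) = lin \<delta> (x - x0) + lin \<delta> d"
      by (simp add: lin_add lin_diff)
    have dx: "down h x = uminus ` ascents \<delta>" using opp[of x] hx ux s by auto
    have flat: "h (w + d) = h w"
      if "h w \<in> {i, i + 1}" "up h w = ascents \<delta>" "lin \<delta> d = 0" for w
    proof -
      have "d \<notin> up h w" "d \<notin> down h w"
        using that opp[of w] by (auto simp: ascents_def lin_minus)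
      then show ?thesis using h_step[OF d, of w] d by (auto simp: up_def down_def)
    qed
    consider "lin \<delta> d = 1" | "lin \<delta> d = -1" | "lin \<delta> d = 0"
      using lin_dir_cases[OF \<delta> d] by blast
    then show ?thesis
    proof cases
      case 1
      then have "d \<in> up h x" using ux d by (simp add: ascents_def)
      moreover have "h x = i" using 1 s l hx by auto
      ultimately show ?thesis using up_step[of d x] hx ux 1 l by (auto simp: up_def)
    next
      case 2
      then have dd: "d \<in> down h x" using dx d descents_eq[of \<delta>] by auto
      have hd: "h (x + d) = i" using 2 s l hx dd by (auto simp: down_def)
      have "up h (x + d + - d) = up h (x + d)"
        using up_step[of "- d" "x + d"] uminus_up_down(2)[OF dd] hd by simp
      then show ?thesis using hd ux 2 l s by auto
    next
      case 3
      have hd: "h (x + d) = h x" using flat[of x] hx ux s 3 by auto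
      have sub: "ascents \<delta> \<subseteq> up h (x + d)"
      proof
        fix u assume u: "u \<in> ascents \<delta>"
        then have ud: "u \<in> dirs" by (simp add: ascents_def)
        show "u \<in> up h (x + d)"
        proof (cases "h x = i")
          case True
          have uu: "u \<in> up h x" using u ux by simp
          then have "h (x + u) = i + 1" "up h (x + u) = ascents \<delta>"
            using up_step[of u x] True ux by (auto simp: up_def)
          then have "h (x + u + d) = i + 1" using flat[of "x + u"] 3 by simp
          moreover have "x + u + d = x + d + u" by simp
          ultimately show ?thesis using hd True ud by (simp add: up_def)
        next
          case False
          then have hx1: "h x = i + 1" using hx s by auto
          have du: "- u \<in> down h x" using u dx by simp
          then have hu: "h (x + - u) = i" using hx1 by (simp add: down_def)
          have "- (- u) \<in> up h (x + - u)" by (rule uminus_up_down(2)[OF du])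
          from up_step[OF this hu] have "up h (x + - u) = ascents \<delta>" using ux by simp
          then have "h (x + - u + d) = i" using flat[of "x + - u"] hu 3 by simp
          moreover have "x + - u + d = x + d + - u" by simp
          ultimately have "h (x + d + - u) = i" by metis
          then have "- u \<in> down h (x + d)" using hd hx1 ud by (simp add: down_def)
          then have "- u \<in> uminus ` up h (x + d)" using opp[of "x + d"] hd hx1 by simp
          then show ?thesis by auto
        qed
      qed
      have "card (ascents \<delta>) = card (up h (x + d))"
        using hd ux card_up[of x] card_up[of "x + d"] by simp
      then have "up h (x + d) = ascents \<delta>" using sub by (metis card_subset_eq finite_up)
      then show ?thesis using hd hx l 3 by simp
    qed
  qed
  have "h y = i + lin \<delta> (y - x0) \<and> up h y = ascents \<delta>"
    using \<delta> y
  proof (induction rule: slab_induct)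
    case base
    then show ?case using x0 by simp
  next
    case (step x d)
    then show ?case using step1[of x d] by blast
  qed
  then show "h y = i + lin \<delta> (y - x0)" and *: "up h y = ascents \<delta>" by auto
  then show "down h y = uminus ` ascents \<delta>" using opp[of y] y by auto
qed

lemma balanced_direction:
  assumes bal: "c i = m" "b i = m" "c (i + 1) = m" and x: "h x = i"
  obtains \<delta> where "sign_pattern \<delta>" "up h x = ascents \<delta>"
proof (rule antipode_free_ascents)
  show "up h x \<subseteq> dirs" by (auto simp: up_def)
  show "- u \<notin> up h x" if "u \<in> up h x" for u
    using uminus_up_subset_down[of x] bal x that up_down_disjoint[of h x] by auto
qed

text \<open>
  Number the layers of the slab so that layer 0 has level \<open>i\<close>; then layer \<open>-1\<close> has level
  \<open>i - 1\<close>. The point is that layer \<open>-2\<close> has constant level. If it contains a vertex of level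
  \<open>i\<close>, then all of \<open>U\<close> is downward there, so the upward directions are \<open>-U\<close>, and the slab that
  starts at this vertex and points the other way covers the whole layer. If it contains a
  vertex of level \<open>i - 1\<close> and none of level \<open>i\<close>, then \<open>b (i - 1) = m\<close>, and the upward directions at
  that vertex are again \<open>-U\<close>; a step along one of them reaches a vertex of level \<open>i\<close> in
  layer \<open>-3\<close>, from which the opposite slab starts. In the remaining case all its levels are \<open>i - 2\<close>.
  The three constants give the three possible parameter pairs.
\<close>

lemma below_balanced_pair:
  assumes i: "0 < i" "i \<le> K" and m: "0 < m"
    and bal: "c i = m" "b i = m" "c (i + 1) = m" "b (i + 1) = m"
  shows "c (i - 1) = m \<and> b (i - 1) = m \<or>
         c (i - 1) = 0 \<and> (b (i - 1) = m \<or> b (i - 1) = 2 * m)"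
proof -
  obtain x0 where x0: "h x0 = i" using level_nonempty[of i] i by auto
  then obtain \<delta> where \<delta>: "sign_pattern \<delta>" and ux0: "up h x0 = ascents \<delta>"
    using balanced_direction bal by metis
  define U where "U = ascents \<delta>"
  define row where "row t = {y. lin \<delta> (y - x0) = t}" for t
  have cU: "card U = m" using card_up[of x0] x0 ux0 bal by (simp add: U_def)
  then obtain u where u: "u \<in> U" using m by fastforce
  have Udirs: "\<And>u. u \<in> U \<Longrightarrow> u \<in> dirs \<and> lin \<delta> u = 1" by (auto simp: U_def ascents_def)
  have row_add: "x + d \<in> row (t + lin \<delta> d)" if "x \<in> row t" for x d t
    using that by (simp add: row_def lin_add lin_diff)
  have row0: "h y = i" "down h y = uminus ` U" if "y \<in> row 0" for y
    using balanced_slab[OF \<delta> bal x0 ux0, of y] that by (auto simp: row_def U_def)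
  have row1: "h z = i - 1" if z: "z \<in> row (-1)" for z
  proof -
    have "z + u \<in> row 0" using row_add[OF z, of u] Udirs[OF u] by simp
    then have "- u \<in> down h (z + u)" "h (z + u) = i" using row0 u by auto
    then show ?thesis by (simp add: down_def)
  qed
  have nbr: "h (y + d) = i - 1" if "y \<in> row (-2)" "d \<in> U" for y d
    using row_add[OF that(1), of d] Udirs[OF that(2)] by (intro row1) simp
  have flip: "sign_pattern (\<lambda>i. - \<delta> i)" using \<delta> by (rule sign_pattern_neg)
  have "\<exists>v\<in>{i - 2, i - 1, i}. \<forall>y\<in>row (-2). h y = v"
  proof (cases "\<exists>y\<in>row (-2). h y = i")
    case True
    then obtain y where y: "y \<in> row (-2)" "h y = i" by blast
    have "U \<subseteq> down h y" using nbr[OF y(1)] y(2) Udirs by (auto simp: down_def)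
    then have "down h y = U"
      using cU bal y(2) card_down[of y] by (metis card_subset_eq finite_down)
    moreover have "uminus ` up h y = down h y"
      using uminus_up_subset_down[of y] bal y(2)
      by (intro card_subset_eq) (auto simp: card_uminus_image card_up card_down)
    ultimately have "up h y = uminus ` U" by (metis (no_types, lifting) image_comp comp_apply add.inverse_inverse image_cong image_ident)
    then have "up h y = ascents (\<lambda>i. - \<delta> i)" by (simp add: ascents_neg U_def)
    from balanced_slab(1)[OF flip bal y(2) this]
    have "h w = i" if "w \<in> row (-2)" for w
      using that y(1) by (simp add: row_def lin_neg lin_diff)
    then show ?thesis by blast
  next
    case False
    show ?thesis
    proof (cases "\<exists>y\<in>row (-2). h y = i - 1")
      case True
      then obtain y where y: "y \<in> row (-2)" "h y = i - 1" by blast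
      have "b (i - 1) = m"
      proof -
        define z where "z = x0 - u"
        have z: "z \<in> row (-1)"
          using Udirs[OF u] by (simp add: z_def row_def lin_minus)
        have "up h z = U"
        proof (intro equalityI subsetI)
          fix d assume "d \<in> up h z"
          then have d: "d \<in> dirs" "h (z + d) = i" using row1[OF z] by (auto simp: up_def)
          have "lin \<delta> d \<noteq> 0" using row_add[OF z, of d] row1[of "z + d"] d by auto
          moreover have "lin \<delta> d \<noteq> -1" using row_add[OF z, of d] False d by auto
          ultimately show "d \<in> U"
            using lin_dir_cases[OF \<delta> d(1)] d by (simp add: U_def ascents_def)
        next
          fix d assume d: "d \<in> U"
          have "h (z + d) = i" using row_add[OF z, of d] Udirs[OF d] by (intro row0) simp
          then show "d \<in> up h z" using row1[OF z] Udirs[OF d] by (simp add: up_def)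
        qed
        then show ?thesis using card_up[of z] row1[OF z] cU by simp
      qed
      have "up h y \<subseteq> uminus ` U"
      proof
        fix d assume "d \<in> up h y"
        then have d: "d \<in> dirs" "h (y + d) = i" using y by (auto simp: up_def)
        have "lin \<delta> d \<noteq> 0" using row_add[OF y(1), of d] False d by auto
        moreover have "lin \<delta> d \<noteq> 1" using row_add[OF y(1), of d] row1[of "y + d"] d by auto
        ultimately have "lin \<delta> d = -1" using lin_dir_cases[OF \<delta> d(1)] by simp
        then show "d \<in> uminus ` U" using d by (simp add: U_def uminus_ascents_iff)
      qed
      then have upy: "up h y = uminus ` U"
        using card_up[of y] y(2) \<open>b (i - 1) = m\<close> cU
        by (intro card_subset_eq) (auto simp: card_uminus_image U_def)
      define w where "w = y + - u"
      have uy: "- u \<in> up h y" using upy u by simp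
      then have hw: "h w = i" using y(2) by (simp add: up_def w_def)
      have "card (up h w) = card (up h y)"
        using hw y(2) bal \<open>b (i - 1) = m\<close> by (simp add: card_up)
      then have "up h w = up h y"
        using up_subset[OF uy] by (intro card_subset_eq) (auto simp: w_def)
      then have upw: "up h w = ascents (\<lambda>i. - \<delta> i)" using upy by (simp add: U_def ascents_neg)
      have "h v = i - 1" if v: "v \<in> row (-2)" for v
      proof -
        have l: "lin (\<lambda>i. - \<delta> i) (v + - u - w) = 0"
          using v y(1) by (simp add: row_def w_def lin_neg lin_diff lin_add)
        have "h (v + - u) = i" "down h (v + - u) = U"
          using balanced_slab[OF flip bal hw upw, of "v + - u"] l
          by (auto simp: U_def ascents_neg image_comp)
        then show ?thesis using u by (auto simp: down_def)
      qed
      then show ?thesis by blast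
    next
      case no: False
      have "h y = i - 2" if y: "y \<in> row (-2)" for y
        using h_step[of u y] nbr[OF y u] Udirs[OF u] False no y by force
      then show ?thesis by blast
    qed
  qed
  then obtain v where v: "v \<in> {i - 2, i - 1, i}" and row2: "\<And>y. y \<in> row (-2) \<Longrightarrow> h y = v"
    by blast
  define z where "z = x0 - u"
  have z: "z \<in> row (-1)"
    using Udirs[OF u] by (simp add: z_def row_def lin_minus)
  note hz = row1[OF z]
  have val: "h (z + d) = (if d \<in> U then i else if d \<in> uminus ` U then v else i - 1)"
    if d: "d \<in> dirs" for d
  proof -
    note ra = row_add[OF z, of d]
    consider "lin \<delta> d = 1" | "lin \<delta> d = -1" | "lin \<delta> d = 0"
      using lin_dir_cases[OF \<delta> d] by blast
    then show ?thesis
    proof cases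
      case 1
      then show ?thesis using ra row0(1)[of "z + d"] d by (simp add: U_def ascents_def)
    next
      case 2
      then have "d \<in> uminus ` U" using d by (simp add: U_def uminus_ascents_iff)
      then show ?thesis using 2 ra row2[of "z + d"] by (simp add: U_def ascents_def)
    next
      case 3
      then have "d \<notin> uminus ` U" using d by (simp add: U_def uminus_ascents_iff)
      then show ?thesis using 3 ra row1[of "z + d"] by (simp add: U_def ascents_def)
    qed
  qed
  have Ud: "U \<subseteq> dirs" "uminus ` U \<subseteq> dirs" using Udirs by auto
  have fU: "finite U" by (simp add: U_def)
  have disj: "U \<inter> uminus ` U = {}" by (simp add: U_def ascents_disjoint)
  have upz: "up h z = (if v = i then U \<union> uminus ` U else U)"
  proof (rule set_eqI)
    show "d \<in> up h z \<longleftrightarrow> d \<in> (if v = i then U \<union> uminus ` U else U)" for d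
      by (cases "d \<in> dirs") (use v Ud val[of d] in \<open>auto simp: up_def hz split: if_splits\<close>)
  qed
  have downz: "down h z = (if v = i - 2 then uminus ` U else {})"
  proof (rule set_eqI)
    show "d \<in> down h z \<longleftrightarrow> d \<in> (if v = i - 2 then uminus ` U else {})" for d
      by (cases "d \<in> dirs") (use v Ud disj val[of d] in \<open>auto simp: down_def hz split: if_splits\<close>)
  qed
  have "card (U \<union> uminus ` U) = 2 * m"
    using cU disj fU by (simp add: card_Un_disjoint card_uminus_image)
  then show ?thesis
    using card_up[of z] card_down[of z] upz downz v cU
    by (auto simp: hz card_uminus_image split: if_splits)
qed

text \<open>
  Only the bottom level has no downward direction, so above it the balanced alternative of
  \<open>below_balanced_pair\<close> must hold and the pair slides down one level.
\<close>

lemma balanced_below: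
  assumes i: "0 < i" "i \<le> K" and m: "0 < m"
    and bal: "c i = m" "b i = m" "c (i + 1) = m" "b (i + 1) = m"
    and t: "0 \<le> t" "t \<le> i"
  shows "{b t, c t} \<subseteq> {0, m, 2 * m}"
proof -
  have bal_all: "c (i - int j) = m \<and> b (i - int j) = m \<and> c (i - int j + 1) = m \<and> b (i - int j + 1) = m"
    if "int j < i" for j
    using that
  proof (induction j)
    case (Suc j)
    define s where "s = i - int j"
    have s: "1 < s" "s \<le> K" using Suc.prems i by (auto simp: s_def)
    have IH: "c s = m" "b s = m" "c (s + 1) = m" "b (s + 1) = m"
      using Suc by (auto simp: s_def)
    have "c (s - 1) \<noteq> 0" using c_pos[of "s - 1"] s by simp
    then have "c (s - 1) = m \<and> b (s - 1) = m"
      using below_balanced_pair[of s m] s m IH by auto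
    then show ?case using IH by (simp add: s_def algebra_simps)
  qed (use bal in simp)
  show ?thesis
  proof (cases "t = 0")
    case True
    have "c 1 = m" "b 1 = m" "c 2 = m" "b 2 = m"
      using bal_all[of "nat (i - 1)"] i by auto
    then show ?thesis
      using below_balanced_pair[of 1 m] i m c_0 True by auto
  next
    case False
    then show ?thesis using bal_all[of "nat (i - t)"] t by auto
  qed
qed

lemma balanced_everywhere:
  assumes i: "0 < i" "i + 1 < K" and m: "0 < m"
    and bal: "c i = m" "b i = m" "c (i + 1) = m" "b (i + 1) = m"
    and t: "0 \<le> t" "t \<le> K"
  shows "{b t, c t} \<subseteq> {0, m, 2 * m}"
proof (cases "t \<le> i")
  case True
  then show ?thesis using balanced_below[of i m t] i m bal t by auto
next
  case False
  have "{c (K - (K - t)), b (K - (K - t))} \<subseteq> {0, m, 2 * m}"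
    by (rule leveling.balanced_below[OF reverse, of "K - i - 1"])
      (use False i m bal t in \<open>auto simp: algebra_simps\<close>)
  then show ?thesis by simp
qed

section \<open>Levels that are constant on hyperplanes\<close>

text \<open>
  A vertex \<open>z\<close> of layer \<open>s + 1\<close> has \<open>m\<close> neighbors in layer \<open>s\<close>, which share the level \<open>v\<close>, and
  \<open>m\<close> neighbors in layer \<open>s + 2\<close>. Since \<open>b w\<close> and \<open>c w\<close> are multiples of \<open>m\<close>, either all or none
  of the latter have level \<open>w - 1\<close>, and likewise for \<open>w + 1\<close>; and the parameters decide which
  alternative holds, uniformly in \<open>z\<close>.
\<close>

lemma next_row_constant:
  assumes \<delta>: "sign_pattern \<delta>" and cm: "card (ascents \<delta>) = m" and m: "0 < m"
    and bc: "\<And>t. 0 \<le> t \<Longrightarrow> t \<le> K \<Longrightarrow> {b t, c t} \<subseteq> {0, m, 2 * m}"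
    and v: "\<And>y. lin \<delta> y = s \<Longrightarrow> h y = v" and w: "\<And>y. lin \<delta> y = s + 1 \<Longrightarrow> h y = w"
  shows "\<exists>v'. \<forall>y. lin \<delta> y = s + 2 \<longrightarrow> h y = v'"
proof -
  define U where "U = ascents \<delta>"
  have Udirs: "\<And>u. u \<in> U \<Longrightarrow> u \<in> dirs \<and> lin \<delta> u = 1" by (auto simp: U_def ascents_def)
  have fU: "finite U" by (simp add: U_def)
  have cU: "card U = m" using cm by (simp add: U_def)
  then obtain u where u: "u \<in> U" using m by fastforce
  \<comment> \<open>Neighbors inside the layer have level \<open>w\<close>, so only the two adjacent layers contribute.\<close>
  have dich: "card {d \<in> dirs. h (z + d) = w'} = card {d \<in> U. h (z + d) = w'} + (if v = w' then m else 0)"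
    if z: "lin \<delta> z = s + 1" and w': "w' \<noteq> w" for z w'
  proof -
    have split: "{d \<in> dirs. h (z + d) = w'} =
        {d \<in> U. h (z + d) = w'} \<union> (if v = w' then uminus ` U else {})" (is "?L = ?R")
    proof -
      have "d \<in> ?L \<longleftrightarrow> d \<in> ?R" if d: "d \<in> dirs" for d
      proof -
        have l: "lin \<delta> (z + d) = s + 1 + lin \<delta> d" using z by (simp add: lin_add)
        have du: "d \<in> uminus ` U \<longleftrightarrow> lin \<delta> d = -1" "d \<in> U \<longleftrightarrow> lin \<delta> d = 1"
          using d by (simp_all add: U_def uminus_ascents_iff) (simp add: ascents_def)
        consider "lin \<delta> d = 1" | "lin \<delta> d = -1" | "lin \<delta> d = 0"
          using lin_dir_cases[OF \<delta> d] by blast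
        then show ?thesis
          using l du d w' v[of "z + d"] w[of "z + d"] by cases auto
      qed
      moreover have "?R \<subseteq> dirs" using Udirs by auto
      ultimately show ?thesis by blast
    qed
    have "U \<inter> uminus ` U = {}" by (simp add: U_def ascents_disjoint)
    then show ?thesis
      unfolding split using fU cU
      by (subst card_Un_disjoint) (auto simp: card_uminus_image)
  qed
  have all_or_none: "(\<forall>z. lin \<delta> z = s + 1 \<longrightarrow> h (z + u) = w') \<or>
      (\<forall>z. lin \<delta> z = s + 1 \<longrightarrow> h (z + u) \<noteq> w')" if w': "w' = w - 1 \<or> w' = w + 1" for w'
  proof (cases "\<exists>z. lin \<delta> z = s + 1 \<and> h (z + u) = w'")
    case True
    define N where "N = (if w' = w - 1 then c w else b w)"
    have N: "card {d \<in> U. h (z + d) = w'} + (if v = w' then m else 0) = N"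
      if z: "lin \<delta> z = s + 1" for z
    proof -
      have "h z = w" using w z by blast
      then have "card {d \<in> dirs. h (z + d) = w'} = N"
        using w' card_up[of z] card_down[of z] by (auto simp: N_def up_def down_def)
      then show ?thesis using dich[OF z, of w'] w' by auto
    qed
    from True obtain z0 where z0: "lin \<delta> z0 = s + 1" "h (z0 + u) = w'" by blast
    have "0 \<le> w" "w \<le> K" using w[of z0] z0 h_bounds by auto
    then have "N \<in> {0, m, 2 * m}" using bc[of w] by (auto simp: N_def)
    moreover define a where "a = card {d \<in> U. h (z0 + d) = w'}"
    have "a > 0"
      using z0 u fU by (auto simp: a_def card_gt_0_iff)
    moreover have "a \<le> m"
      using card_mono[of U "{d \<in> U. h (z0 + d) = w'}"] fU cU by (auto simp: a_def)
    moreover have "a + (if v = w' then m else 0) = N"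
      using N[OF z0(1)] by (simp add: a_def)
    ultimately have Neq: "N = m + (if v = w' then m else 0)"
      using m by (auto split: if_splits)
    have "h (z + u) = w'" if z: "lin \<delta> z = s + 1" for z
    proof -
      have "card {d \<in> U. h (z + d) = w'} = card U" using N[OF z] Neq cU by simp
      then have "{d \<in> U. h (z + d) = w'} = U" using fU by (intro card_subset_eq) auto
      then show ?thesis using u by blast
    qed
    then show ?thesis by blast
  qed blast
  have near: "h (z + u) \<in> {w - 1, w, w + 1}" if "lin \<delta> z = s + 1" for z
    using h_step[of u z] w[OF that] Udirs[OF u] by auto
  have "\<exists>v'. \<forall>z. lin \<delta> z = s + 1 \<longrightarrow> h (z + u) = v'"
    using all_or_none[of "w - 1"] all_or_none[of "w + 1"] near by blast
  then obtain v' where v': "\<And>z. lin \<delta> z = s + 1 \<Longrightarrow> h (z + u) = v'" by blast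
  have "h y = v'" if "lin \<delta> y = s + 2" for y
    using v'[of "y - u"] that Udirs[OF u] by (simp add: lin_diff)
  then show ?thesis by blast
qed

lemma rows_constant:
  assumes \<delta>: "sign_pattern \<delta>" and cm: "card (ascents \<delta>) = m" and m: "0 < m"
    and bc: "\<And>t. 0 \<le> t \<Longrightarrow> t \<le> K \<Longrightarrow> {b t, c t} \<subseteq> {0, m, 2 * m}"
    and v: "\<And>y. lin \<delta> y = s \<Longrightarrow> h y = v" and w: "\<And>y. lin \<delta> y = s + 1 \<Longrightarrow> h y = w"
    and xy: "lin \<delta> x = lin \<delta> y"
  shows "h x = h y"
proof -
  define C where "C t \<longleftrightarrow> (\<exists>v. \<forall>y. lin \<delta> y = t \<longrightarrow> h y = v)" for t
  have C0: "C s" "C (s + 1)" using v w by (auto simp: C_def)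
  have up: "C (t + 2)" if "C t" "C (t + 1)" for t
    using that next_row_constant[OF \<delta> cm m bc] unfolding C_def by metis
  have flip: "sign_pattern (\<lambda>i. - \<delta> i)" using \<delta> by (rule sign_pattern_neg)
  have cm': "card (ascents (\<lambda>i. - \<delta> i)) = m" using cm by (simp add: ascents_neg card_uminus_image)
  have down: "C (t - 1)" if C: "C t" "C (t + 1)" for t
  proof -
    obtain v where v: "\<forall>y. lin \<delta> y = t \<longrightarrow> h y = v" using C(1) by (auto simp: C_def)
    obtain w where w: "\<forall>y. lin \<delta> y = t + 1 \<longrightarrow> h y = w" using C(2) by (auto simp: C_def)
    \<comment> \<open>For \<open>-\<delta>\<close> the layers \<open>t + 1\<close>, \<open>t\<close>, \<open>t - 1\<close> have the increasing numbers
      \<open>-t - 1\<close>, \<open>-t\<close>, \<open>-t + 1\<close>.\<close>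
    have "\<exists>v'. \<forall>y. lin (\<lambda>i. - \<delta> i) y = (- t - 1) + 2 \<longrightarrow> h y = v'"
      by (rule next_row_constant[OF flip cm' m bc, where v = w and w = v])
        (use v w in \<open>auto simp: lin_neg\<close>)
    moreover have "lin (\<lambda>i. - \<delta> i) y = (- t - 1) + 2 \<longleftrightarrow> lin \<delta> y = t - 1" for y
      by (simp add: lin_neg) linarith
    ultimately show ?thesis by (simp add: C_def)
  qed
  have "C t \<and> C (t + 1)" for t
  proof (induction t rule: int_induct[of _ s])
    case base
    then show ?case using C0 by simp
  next
    case (step1 t)
    then show ?case using up[of t] by (simp add: algebra_simps)
  next
    case (step2 t)
    then show ?case using down[of t] by simp
  qed
  then show ?thesis using xy unfolding C_def by metis
qed

text \<open>
  The linear form comes from the upward directions at one vertex of a balanced level; the slab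
  through that vertex provides the two consecutive constant layers from which all others follow.
\<close>

lemma many_levels_one_dimensional:
  assumes K: "K > 2 * int CARD('n)"
  obtains \<delta> j where "sign_pattern \<delta>" "\<delta> j \<noteq> 0" "\<And>x y. lin \<delta> x = lin \<delta> y \<Longrightarrow> h x = h y"
proof -
  obtain i m where i: "0 < i" "i + 1 < K" and m: "0 < m"
    and bal: "c i = m" "b i = m" "c (i + 1) = m" "b (i + 1) = m"
    using balanced_pair_exists[OF K] by blast
  obtain x0 where x0: "h x0 = i" using level_nonempty[of i] i by auto
  then obtain \<delta> where \<delta>: "sign_pattern \<delta>" and ux0: "up h x0 = ascents \<delta>"
    using balanced_direction bal by metis
  have cm: "card (ascents \<delta>) = m" using card_up[of x0] x0 ux0 bal by simp
  then obtain u where u: "u \<in> ascents \<delta>" using m by fastforce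
  obtain j where j: "\<delta> j \<noteq> 0"
    using u unfolding ascents_def lin_def by (force simp: sum.neutral)
  have slab: "h y = i + lin \<delta> (y - x0)" if "lin \<delta> (y - x0) \<in> {0, 1}" for y
    using balanced_slab(1)[OF \<delta> bal x0 ux0] that by blast
  have const: "h x = h y" if "lin \<delta> x = lin \<delta> y" for x y
    by (rule rows_constant[OF \<delta> cm m balanced_everywhere[OF i m bal], where s = "lin \<delta> x0" and v = i and w = "i + 1"])
      (use slab that in \<open>auto simp: lin_diff\<close>)
  show ?thesis by (rule that[OF \<delta> j const])
qed

end

section \<open>From colorings to levels\<close>

text \<open>
  The level of a vertex is the position of its color in the three-diagonal ordering, counted from
  0. The zero entries of the matrix say that adjacent levels differ by at most one.
\<close>

lemma distance_regular_leveling: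
  fixes \<phi> :: "int ^ 'n \<Rightarrow> nat"
  assumes "distance_regular_coloring k \<phi>"
  obtains h b c where "leveling h (int k - 1) b c" "\<And>x y. h x = h y \<Longrightarrow> \<phi> x = \<phi> y"
proof -
  obtain A \<pi> where perf: "perfect_coloring k A \<phi>" and bij: "bij_betw \<pi> {1..k} {1..k}"
    and tri: "\<And>i j. i \<in> {1..k} \<Longrightarrow> j \<in> {1..k} \<Longrightarrow> \<bar>int i - int j\<bar> > 1 \<Longrightarrow> A (\<pi> i) (\<pi> j) = 0"
    using assms unfolding distance_regular_coloring_def by blast
  have range_phi: "range \<phi> = {1..k}"
    using perf by (simp add: perfect_coloring_def grid_coloring_def)
  have count: "card {d \<in> dirs. \<phi> (x + d) = j} = A (\<phi> x) j" if "j \<in> {1..k}" for x j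
  proof -
    have "\<phi> x \<in> {1..k}" using range_phi by (metis rangeI)
    then have "card {y. grid_adj x y \<and> \<phi> y = j} = A (\<phi> x) j"
      using perf that unfolding perfect_coloring_def by blast
    then show ?thesis by (simp add: card_neighbors)
  qed
  define r where "r x = inv_into {1..k} \<pi> (\<phi> x)" for x
  have r: "r x \<in> {1..k}" "\<pi> (r x) = \<phi> x" for x
  proof -
    have "\<phi> x \<in> \<pi> ` {1..k}" using range_phi bij by (metis bij_betw_imp_surj_on rangeI)
    then show "r x \<in> {1..k}" "\<pi> (r x) = \<phi> x"
      unfolding r_def by (rule inv_into_into, rule f_inv_into_f)
  qed
  have r_iff: "r x = j \<longleftrightarrow> \<phi> x = \<pi> j" if "j \<in> {1..k}" for x j
    using r[of x] that bij unfolding bij_betw_def by (metis inj_onD)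
  define h where "h x = int (r x) - 1" for x
  \<comment> \<open>Levels outside \<open>0, \<dots>, k - 1\<close> do not occur, hence the default value 0.\<close>
  define N where "N t s = (if 0 \<le> s \<and> s < int k then A (\<pi> (nat (t + 1))) (\<pi> (nat (s + 1))) else 0)" for t s
  have N: "card {d \<in> dirs. h (x + d) = s} = N (h x) s" for x s
  proof (cases "0 \<le> s \<and> s < int k")
    case True
    define j where "j = nat (s + 1)"
    have j: "j \<in> {1..k}" "s = int j - 1" using True by (auto simp: j_def)
    have "{d \<in> dirs. h (x + d) = s} = {d \<in> dirs. \<phi> (x + d) = \<pi> j}"
      using r_iff[OF j(1)] by (auto simp: h_def j(2))
    moreover have "\<pi> j \<in> {1..k}" using bij_betwE[OF bij] j(1) by blast
    ultimately have "card {d \<in> dirs. h (x + d) = s} = A (\<phi> x) (\<pi> j)"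
      by (simp only: count)
    then show ?thesis using True r(2)[of x] by (simp add: N_def j_def h_def)
  next
    case False
    have "h (x + d) \<noteq> s" for d using False r(1)[of "x + d"] by (auto simp: h_def)
    moreover have "N (h x) s = 0" using False unfolding N_def by (rule if_not_P)
    ultimately show ?thesis by simp
  qed
  have "leveling h (int k - 1) (\<lambda>t. N t (t + 1)) (\<lambda>t. N t (t - 1))"
  proof
    show "range h = {0..int k - 1}"
    proof (intro equalityI subsetI)
      fix t assume "t \<in> range h"
      then obtain x where "t = h x" by auto
      then show "t \<in> {0..int k - 1}" using r(1)[of x] by (auto simp: h_def)
    next
      fix t assume t: "t \<in> {0..int k - 1}"
      define j where "j = nat (t + 1)"
      have j: "j \<in> {1..k}" "t = int j - 1" using t by (auto simp: j_def)
      then have "\<pi> j \<in> range \<phi>" unfolding range_phi using bij_betwE[OF bij] by blast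
      then obtain x where "\<phi> x = \<pi> j" by (metis imageE)
      then have "h x = t" using r_iff[OF j(1), of x] j(2) by (simp add: h_def)
      then show "t \<in> range h" by auto
    qed
  next
    fix d :: "int ^ 'n" and x :: "int ^ 'n"
    assume d: "d \<in> dirs"
    show "\<bar>h (x + d) - h x\<bar> \<le> 1"
    proof (rule ccontr)
      assume "\<not> ?thesis"
      then have "\<bar>int (r x) - int (r (x + d))\<bar> > 1" by (simp add: h_def)
      from tri[OF r(1) r(1) this] have "A (\<phi> x) (\<phi> (x + d)) = 0" by (simp only: r(2))
      moreover have "\<phi> (x + d) \<in> {1..k}" unfolding range_phi[symmetric] by (rule rangeI)
      ultimately have "card {e \<in> dirs. \<phi> (x + e) = \<phi> (x + d)} = 0"
        by (simp only: count)
      then have "{e \<in> dirs. \<phi> (x + e) = \<phi> (x + d)} = {}" by simp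
      then show False using d by blast
    qed
  qed (simp_all add: up_def down_def N)
  moreover have "\<phi> x = \<phi> y" if "h x = h y" for x y
    using r(2)[of x] r(2)[of y] that by (simp add: h_def)
  ultimately show ?thesis by (rule that)
qed

text \<open>
  On the axis \<open>j\<close> the form \<open>lin \<delta>\<close> takes every integer value, so the coloring of the line can be
  read off from that axis.
\<close>

lemma reducible_coloringI:
  fixes \<phi> :: "int ^ 'n \<Rightarrow> nat"
  assumes k: "grid_coloring k \<phi>" and \<delta>: "sign_pattern \<delta>" "\<delta> j \<noteq> 0"
    and const: "\<And>x y. lin \<delta> x = lin \<delta> y \<Longrightarrow> \<phi> x = \<phi> y"
  shows "reducible_coloring k \<phi>"
proof -
  define \<phi>1 :: "int ^ 1 \<Rightarrow> nat" where "\<phi>1 = (\<lambda>v. \<phi> (axis j (\<delta> j * v $ 1)))"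
  \<comment> \<open>The factor \<open>\<delta> j\<close> compensates the sign with which the axis enters the form.\<close>
  have "\<delta> j * \<delta> j = 1" using \<delta>(1)[rule_format, of j] \<delta>(2) by auto
  then have "lin \<delta> (axis j (\<delta> j * t)) = t" for t by (simp add: mult.assoc[symmetric])
  then have eq: "\<phi> x = \<phi>1 (\<chi> _. \<Sum>i\<in>UNIV. \<delta> i * x $ i)" for x
    unfolding \<phi>1_def by (intro const) (simp add: lin_def)
  have "range \<phi>1 = range \<phi>"
  proof (intro equalityI subsetI)
    fix a assume "a \<in> range \<phi>"
    then obtain x where "a = \<phi> x" by auto
    then show "a \<in> range \<phi>1" using eq[of x] by simp
  qed (auto simp: \<phi>1_def)
  then have "grid_coloring k \<phi>1" using k by (simp add: grid_coloring_def)
  then show ?thesis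
    unfolding reducible_coloring_def using \<delta>(1) eq by blast
qed

lemma irreducible_distance_regular_bound:
  fixes \<phi> :: "int ^ 'n \<Rightarrow> nat"
  assumes dr: "distance_regular_coloring k \<phi>" and irr: "irreducible_coloring k \<phi>"
  shows "k \<le> 2 * CARD('n) + 1"
proof (rule ccontr)
  assume "\<not> ?thesis"
  then have K: "int k - 1 > 2 * int CARD('n)" by simp
  obtain h b c where lev: "leveling h (int k - 1) b c" and h: "\<And>x y. h x = h y \<Longrightarrow> \<phi> x = \<phi> y"
    using distance_regular_leveling[OF dr] by metis
  obtain \<delta> j where \<delta>: "sign_pattern \<delta>" "\<delta> j \<noteq> 0"
    and const: "\<And>x y. lin \<delta> x = lin \<delta> y \<Longrightarrow> h x = h y"
    using leveling.many_levels_one_dimensional[OF lev K] by metis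
  have "grid_coloring k \<phi>"
    using dr by (auto simp: distance_regular_coloring_def perfect_coloring_def)
  then have "reducible_coloring k \<phi>"
    by (rule reducible_coloringI[OF _ \<delta>]) (rule h[OF const])
  then show False using irr by simp
qed

section \<open>The Lee weight modulo 4\<close>

text \<open>
  The distance of the residue of \<open>a\<close> to 0 on the cycle of length 4.
\<close>

definition lee4 :: "int \<Rightarrow> nat" where
  "lee4 a = (if a mod 4 = 0 then 0 else if a mod 4 = 2 then 2 else 1)"

lemma lee4_cases:
  obtains "lee4 a = 0" "lee4 (a + 1) = 1" "lee4 (a - 1) = 1"
  | "lee4 a = 1" "lee4 (a + 1) = 2" "lee4 (a - 1) = 0"
  | "lee4 a = 1" "lee4 (a + 1) = 0" "lee4 (a - 1) = 2"
  | "lee4 a = 2" "lee4 (a + 1) = 1" "lee4 (a - 1) = 1"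
proof -
  have "a mod 4 = 0 \<or> a mod 4 = 1 \<or> a mod 4 = 2 \<or> a mod 4 = 3" by presburger
  then consider "a mod 4 = 0" | "a mod 4 = 1" | "a mod 4 = 2" | "a mod 4 = 3" by blast
  then show ?thesis
  proof cases
    case 1
    then have "(a + 1) mod 4 = 1" "(a - 1) mod 4 = 3" by presburger+
    with 1 show ?thesis by (intro that(1)) (simp_all add: lee4_def)
  next
    case 2
    then have "(a + 1) mod 4 = 2" "(a - 1) mod 4 = 0" by presburger+
    with 2 show ?thesis by (intro that(2)) (simp_all add: lee4_def)
  next
    case 3
    then have "(a + 1) mod 4 = 3" "(a - 1) mod 4 = 1" by presburger+
    with 3 show ?thesis by (intro that(4)) (simp_all add: lee4_def)
  next
    case 4
    then have "(a + 1) mod 4 = 0" "(a - 1) mod 4 = 2" by presburger+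
    with 4 show ?thesis by (intro that(3)) (simp_all add: lee4_def)
  qed
qed

text \<open>
  Read along one axis: of the two neighbors of \<open>a\<close>, exactly \<open>2 - lee4 a\<close> are farther from 0 and
  exactly \<open>lee4 a\<close> are closer. Summed over the axes this gives the parameters \<open>2n - i\<close> and \<open>i\<close>.
\<close>

lemma lee4_neighbors:
  "of_bool (lee4 (a + 1) = lee4 a + 1) + of_bool (lee4 (a - 1) = lee4 a + 1) = 2 - lee4 a"
  "of_bool (lee4 (a + 1) + 1 = lee4 a) + of_bool (lee4 (a - 1) + 1 = lee4 a) = lee4 a"
  "lee4 (a + 1) = lee4 a + 1 \<or> lee4 (a + 1) + 1 = lee4 a"
  "lee4 (a - 1) = lee4 a + 1 \<or> lee4 (a - 1) + 1 = lee4 a"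
  "lee4 a \<le> 2"
  by (cases rule: lee4_cases[of a]; simp)+

definition lee_weight :: "int ^ 'n \<Rightarrow> nat" where
  "lee_weight x = (\<Sum>i\<in>UNIV. lee4 (x $ i))"

lemma lee_weight_add_axis:
  fixes x :: "int ^ 'n"
  shows "lee_weight (x + axis i t) + lee4 (x $ i) = lee_weight x + lee4 (x $ i + t)"
proof -
  have "lee_weight y = lee4 (y $ i) + (\<Sum>j\<in>UNIV - {i}. lee4 (y $ j))" for y :: "int ^ 'n"
    unfolding lee_weight_def by (rule sum.remove) auto
  moreover have "(\<Sum>j\<in>UNIV - {i}. lee4 ((x + axis i t) $ j)) = (\<Sum>j\<in>UNIV - {i}. lee4 (x $ j))"
    by (rule sum.cong) (auto simp: axis_def)
  ultimately show ?thesis by (simp add: axis_def)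
qed

lemma lee_weight_diff_axis:
  fixes x :: "int ^ 'n"
  shows "lee_weight (x + - axis i t) + lee4 (x $ i) = lee_weight x + lee4 (x $ i - t)"
proof -
  have "- axis i t = axis i (- t)" by (simp add: vec_eq_iff axis_def)
  then show ?thesis using lee_weight_add_axis[of x i "- t"] by simp
qed

lemma lee_weight_le: "lee_weight (x :: int ^ 'n) \<le> 2 * CARD('n)"
proof -
  have "lee_weight x \<le> (\<Sum>i\<in>(UNIV :: 'n set). 2)"
    unfolding lee_weight_def by (rule sum_mono) (rule lee4_neighbors(5))
  then show ?thesis by (simp add: mult.commute)
qed

lemma lee_weight_neighbor_iff:
  "lee_weight (x + axis i 1) + 1 = lee_weight x \<longleftrightarrow> lee4 (x $ i + 1) + 1 = lee4 (x $ i)"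
  "lee_weight (x + - axis i 1) + 1 = lee_weight x \<longleftrightarrow> lee4 (x $ i - 1) + 1 = lee4 (x $ i)"
  "lee_weight (x + axis i 1) = lee_weight x + 1 \<longleftrightarrow> lee4 (x $ i + 1) = lee4 (x $ i) + 1"
  "lee_weight (x + - axis i 1) = lee_weight x + 1 \<longleftrightarrow> lee4 (x $ i - 1) = lee4 (x $ i) + 1"
  using lee_weight_add_axis[of x i 1] lee_weight_diff_axis[of x i 1] by linarith+

lemma lee_weight_step:
  assumes "d \<in> dirs"
  shows "lee_weight (x + d) = lee_weight x + 1 \<or> lee_weight (x + d) + 1 = lee_weight x"
  using assms
proof (cases rule: dirs_cases)
  case (1 i)
  then show ?thesis by (simp only: lee_weight_neighbor_iff lee4_neighbors)
next
  case (2 i)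
  then show ?thesis by (simp only: lee_weight_neighbor_iff lee4_neighbors)
qed

lemma card_lee_weight_down: "card {d \<in> dirs. lee_weight (x + d) + 1 = lee_weight x} = lee_weight x"
  by (simp only: card_dirs_filter lee_weight_neighbor_iff lee4_neighbors(2)) (simp only: lee_weight_def)

lemma card_lee_weight_up:
  "card {d \<in> dirs. lee_weight (x + d) = lee_weight x + 1} = 2 * CARD('n) - lee_weight (x :: int ^ 'n)"
proof -
  have "card {d \<in> dirs. lee_weight (x + d) = lee_weight x + 1} = (\<Sum>i\<in>UNIV. 2 - lee4 (x $ i))"
    by (simp only: card_dirs_filter lee_weight_neighbor_iff lee4_neighbors(1))
  also have "\<dots> = 2 * CARD('n) - lee_weight x"
    unfolding lee_weight_def by (subst sum_subtractf_nat) (simp_all add: lee4_neighbors(5))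
  finally show ?thesis .
qed

lemma lee_weight_surj:
  assumes "t \<le> 2 * CARD('n)" shows "\<exists>x :: int ^ 'n. lee_weight x = t"
  using assms
proof (induction t)
  case 0
  have "lee_weight (0 :: int ^ 'n) = 0" by (simp add: lee_weight_def lee4_def)
  then show ?case by blast
next
  case (Suc t)
  then obtain x :: "int ^ 'n" where x: "lee_weight x = t" by auto
  have "card {d \<in> dirs. lee_weight (x + d) = lee_weight x + 1} \<noteq> 0"
    unfolding card_lee_weight_up using Suc.prems x by simp
  then have "{d \<in> dirs. lee_weight (x + d) = lee_weight x + 1} \<noteq> {}"
    by (rule contrapos_nn) (simp only: card.empty)
  then obtain d where "lee_weight (x + d) = lee_weight x + 1" by blast
  then have "lee_weight (x + d) = Suc t" using x by simp
  then show ?case by blast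
qed

lemma lee_weight_distance_regular:
  "distance_regular_coloring (2 * CARD('n) + 1) (\<lambda>x :: int ^ 'n. lee_weight x + 1)"
proof -
  let ?k = "2 * CARD('n) + 1" and ?\<phi> = "\<lambda>x :: int ^ 'n. lee_weight x + 1"
  \<comment> \<open>Color \<open>i\<close> has weight \<open>i - 1\<close>, so the upward parameter \<open>2n - (i - 1)\<close> is \<open>?k - i\<close> and
    the downward parameter \<open>i - 1\<close> is the target color \<open>j\<close>.\<close>
  define A where "A i j = (if j = i + 1 then ?k - i else if i = j + 1 then j else 0)" for i j :: nat
  have "range ?\<phi> = {1..?k}"
  proof (intro equalityI subsetI)
    fix j assume j: "j \<in> {1..?k}"
    then have "j - 1 \<le> 2 * CARD('n)" by auto
    then obtain x :: "int ^ 'n" where "lee_weight x = j - 1" using lee_weight_surj by blast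
    then have "j = ?\<phi> x" using j by simp
    then show "j \<in> range ?\<phi>" by blast
  qed (use lee_weight_le in auto)
  moreover have "card {y. grid_adj x y \<and> ?\<phi> y = j} = A (?\<phi> x) j" for x j
  proof -
    have eq: "card {y. grid_adj x y \<and> ?\<phi> y = j} = card {d \<in> dirs. ?\<phi> (x + d) = j}"
      by (rule card_neighbors)
    consider "j = lee_weight x + 2" | "j = lee_weight x" | "j \<noteq> lee_weight x + 2" "j \<noteq> lee_weight x" by blast
    then show ?thesis
    proof cases
      case 1
      then show ?thesis using eq card_lee_weight_up[of x] by (simp add: A_def)
    next
      case 2
      then show ?thesis using eq card_lee_weight_down[of x] by (simp add: A_def)
    next
      case 3
      then have "{d \<in> dirs. ?\<phi> (x + d) = j} = {}" using lee_weight_step[of _ x] by fastforce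
      then show ?thesis using 3 by (simp only: eq) (simp add: A_def)
    qed
  qed
  ultimately have "perfect_coloring ?k A ?\<phi>"
    by (simp add: perfect_coloring_def grid_coloring_def)
  moreover have "A (id i) (id j) = 0" if "\<bar>int i - int j\<bar> > 1" for i j
    using that by (auto simp: A_def)
  ultimately show ?thesis
    unfolding distance_regular_coloring_def using bij_betw_id by blast
qed

text \<open>
  Weight 0 is attained only on multiples of 4, so a vector on which the form vanishes must have all
  coordinates divisible by 4. A zero coefficient is excluded by twice a unit vector, and two nonzero coefficients
  by a combination of two unit vectors on which they cancel.
\<close>

lemma lee_weight_irreducible:
  assumes "CARD('n) \<ge> 2"
  shows "irreducible_coloring k (\<lambda>x :: int ^ 'n. lee_weight x + 1)"
proof
  assume "reducible_coloring k (\<lambda>x :: int ^ 'n. lee_weight x + 1)"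
  then obtain \<phi>1 :: "int ^ 1 \<Rightarrow> nat" and \<delta> :: "'n \<Rightarrow> int" where \<delta>: "sign_pattern \<delta>"
    and \<phi>1: "\<And>x :: int ^ 'n. lee_weight x + 1 = \<phi>1 (\<chi> _. lin \<delta> x)"
    unfolding reducible_coloring_def lin_def by blast
  have zero: "lee4 (x $ i) = 0" if "lin \<delta> x = 0" for x :: "int ^ 'n" and i
  proof -
    have "lee_weight x = lee_weight (0 :: int ^ 'n)"
      using \<phi>1[of x] \<phi>1[of 0] that by simp
    then show ?thesis by (simp add: lee_weight_def lee4_def[of 0])
  qed
  have nz: "\<delta> i \<noteq> 0" for i
  proof
    assume "\<delta> i = 0"
    then have "lee4 (axis i 2 $ i) = 0" by (intro zero) simp
    then show False by (simp add: lee4_def)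
  qed
  obtain i :: 'n where True by simp
  have "UNIV \<noteq> {i}"
  proof
    assume "UNIV = {i}"
    then have "CARD('n) = card {i}" by simp
    then show False using assms by simp
  qed
  then obtain j where ij: "j \<noteq> i" by auto
  have sq: "\<delta> l * \<delta> l = 1" for l using \<delta>[rule_format, of l] nz[of l] by auto
  have "lee4 ((axis i (\<delta> i) - axis j (\<delta> j)) $ i) = 0"
    by (rule zero) (simp add: lin_diff sq)
  then have "lee4 (\<delta> i) = 0" using ij by (simp add: axis_def)
  then show False using \<delta>[rule_format, of i] nz[of i] by (auto simp: lee4_def)
qed

theorem theorem4:
  "(\<forall>k (\<phi> :: int ^ 'n \<Rightarrow> nat).
      distance_regular_coloring k \<phi> \<and> irreducible_coloring k \<phi> \<longrightarrow> k \<le> 2 * CARD('n) + 1) \<and>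
   (CARD('n) \<ge> 2 \<longrightarrow>
      (\<exists>\<phi> :: int ^ 'n \<Rightarrow> nat.
         distance_regular_coloring (2 * CARD('n) + 1) \<phi> \<and>
         irreducible_coloring (2 * CARD('n) + 1) \<phi>))"
  using irreducible_distance_regular_bound lee_weight_distance_regular lee_weight_irreducible
  by blast

end
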